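(* Let $m\ge 2$ be an integer, let $\lambda\in\mathbb{C}\setminus\{0\}$, and let $F_{\lambda,m}(z)=\lambda z^m\exp(z)$. Then the following hold. 1. Let $\epsilon_0=\epsilon_0(|\lambda|,m)>0$ be the unique positive solution of $x^{m-1}e^x=1/|\lambda|$. Then $A^*(0)$ contains the disk $D_{\epsilon_0}=\{z\in\mathbb{C} : |z|<\epsilon_0\}$. 2. There exist a real number $x_0=x_0(|\lambda|,m)<0$ and a function $C:(-\infty,x_0)\to[0,\infty)$, depending only on $|\lambda|$ and $m$, such that the set $$H_{|\lambda|,m}=\{x+yi : x\in(-\infty,x_0),\ y\in(-C(x),C(x))\}$$ is open and satisfies $F_{\lambda,m}(H_{|\lambda|,m})\subset D_{\epsilon_0}$. 3. For this same set $H_{|\lambda|,m}$, there exist infinitely many pairwise disjoint horizontal strips $S^k_{\lambda,m}$ which are preimages of $H_{|\lambda|,m}$, in the sense that $F_{\lambda,m}(S^k_{\lambda,m})\subset H_{|\lambda|,m}$. These strips extend to $+\infty$ and have asymptotic width equal to $\pi$.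
   Context: The point $z=0$ is a superattracting fixed point of $F_{\lambda,m}$. Its basin of attraction is $A(0)=\{z\in\mathbb{C} : F_{\lambda,m}^{\circ n}(z)\to 0 \text{ as } n\to\infty\}$, and $A^*(0)$ denotes the connected component of $A(0)$ containing $0$. A horizontal strip extending to $+\infty$ with asymptotic width $w>0$ means a connected open set $S\subset\mathbb{C}$ for which there is $c\in\mathbb{R}$ such that: for every real $y$ with $|y-c|<w/2$ there is $x_*\in\mathbb{R}$ with $x+yi\in S$ for all $x\ge x_*$; and for every real $y$ with $|y-c|>w/2$ there is $x_*\in\mathbb{R}$ with $x+yi\notin S$ for all $x\ge x_*$. *)

theory Defs
  imports "HOL-Analysis.Analysis"
begin

definition F :: "complex \<Rightarrow> nat \<Rightarrow> complex \<Rightarrow> complex" where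
  "F lam m z = lam * z ^ m * exp z"

definition basin0 :: "complex \<Rightarrow> nat \<Rightarrow> complex set" where
  "basin0 lam m = {z. (\<lambda>n. (F lam m ^^ n) z) \<longlonglongrightarrow> 0}"

definition immediate_basin0 :: "complex \<Rightarrow> nat \<Rightarrow> complex set" where
  "immediate_basin0 lam m = connected_component_set (basin0 lam m) 0"

(* The parameter r of eps0 stands for the modulus of lam. *)
definition is_eps0 :: "real \<Rightarrow> nat \<Rightarrow> real \<Rightarrow> bool" where
  "is_eps0 r m x \<longleftrightarrow> 0 < x \<and> x ^ (m - 1) * exp x = 1 / r"

definition eps0 :: "real \<Rightarrow> nat \<Rightarrow> real" where
  "eps0 r m = (THE x. is_eps0 r m x)"

(* Only the values of C on {..<x0} matter. *)
definition H_region :: "real \<Rightarrow> (real \<Rightarrow> real) \<Rightarrow> complex set" where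
  "H_region x0 C = {Complex x y | x y. x \<in> {..<x0} \<and> y \<in> {- C x<..<C x}}"

definition horizontal_strip :: "real \<Rightarrow> complex set \<Rightarrow> bool" where
  "horizontal_strip w S \<longleftrightarrow>
     0 < w \<and> open S \<and> connected S \<and>
     (\<exists>c::real.
        (\<forall>y. \<bar>y - c\<bar> < w / 2 \<longrightarrow> (\<exists>xs. \<forall>x\<ge>xs. Complex x y \<in> S)) \<and>
        (\<forall>y. \<bar>y - c\<bar> > w / 2 \<longrightarrow> (\<exists>xs. \<forall>x\<ge>xs. Complex x y \<notin> S)))"

end

theory Submission
  imports Defs
begin

text \<open>Write \<open>F z = \<lambda> z\<^sup>m e\<^sup>z\<close>.  For \<open>\<bar>z\<bar> = s\<close> one has
  \<open>\<bar>F z\<bar> \<le> q s\<close> with \<open>q = \<bar>\<lambda>\<bar> s\<^sup>m\<^sup>-\<^sup>1 e\<^sup>s\<close>, and \<open>q\<close> increases strictly with \<open>s\<close> and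
  reaches \<open>1\<close> exactly at \<open>\<epsilon>\<^sub>0\<close>.  So on the disk of radius \<open>\<epsilon>\<^sub>0\<close> the iterates of a
  point decay geometrically (\<open>iterate_decay\<close>), and the disk, being connected, lies in
  the immediate basin.

  Far to the left the factor \<open>e\<^sup>x\<close> beats every power of \<open>\<bar>z\<bar>\<close>, as long as \<open>\<bar>z\<bar>\<close> is bounded by a
  polynomial in \<open>x\<close>.  Therefore the simple choice \<open>C(x) = x\<^sup>2\<close> already gives a region
  mapped into the disk (\<open>H_region_maps_into_ball\<close>).  What matters for the strips is that
  \<open>C\<close> grows faster than linearly: every sector around the negative real axis with half-opening less
  than \<open>\<pi>/2\<close> is, apart from a bounded part, contained in the region.

  Let \<open>c\<close> be a height with \<open>\<lambda> e\<^sup>i\<^sup>c = -\<bar>\<lambda>\<bar>\<close>; these heights form a progression of step \<open>2\<pi>\<close>.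
  For \<open>z = x + iy\<close> with \<open>y\<close> bounded and \<open>x \<rightarrow> +\<infinity>\<close>, \<open>z\<^sup>m\<close> is asymptotic to \<open>x\<^sup>m\<close>, so
  \<open>F z\<close> is asymptotic to \<open>-\<bar>\<lambda>\<bar> x\<^sup>m e\<^sup>x e\<^sup>i\<^sup>(\<^sup>y\<^sup>-\<^sup>c\<^sup>)\<close>.  If \<open>\<bar>y - c\<bar> < b < \<pi>/2\<close>, this tends to
  infinity inside a sector as above, uniformly in \<open>y\<close>; hence a half-strip of half-width
  \<open>b\<close> is mapped into the region (\<open>half_strip_maps_into_H\<close>).  The union of all such
  half-strips over \<open>b < \<pi>/2\<close> is the required strip of asymptotic width \<open>\<pi>\<close>.\<close>

section \<open>The disk in the immediate basin\<close>

lemma power_mult_exp_strict_mono: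
  fixes x y :: real
  assumes "0 \<le> x" "x < y"
  shows "x ^ k * exp x < y ^ k * exp y"
proof -
  have "x ^ k * exp x \<le> y ^ k * exp x"
    using assms by (intro mult_right_mono power_mono) auto
  also have "\<dots> < y ^ k * exp y"
    using assms by (intro mult_strict_left_mono) auto
  finally show ?thesis .
qed

lemma ex1_is_eps0:
  assumes r: "0 < r" and m: "2 \<le> m"
  shows "\<exists>!x. is_eps0 r m x"
proof -
  define h where "h x = x ^ (m - 1) * exp x" for x :: real
  define b where "b = max 1 (1 / r)"
  have h0: "h 0 = 0" using m by (simp add: h_def)
  have b: "1 \<le> b" "1 / r \<le> b" by (auto simp: b_def)
  have "b \<le> exp b"
    using exp_ge_add_one_self[of b] by linarith
  also have "\<dots> \<le> h b"
    using b(1) by (simp add: h_def one_le_power)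
  finally have hb: "1 / r \<le> h b" using b(2) by linarith
  have "continuous_on {0..b} h" unfolding h_def by (intro continuous_intros)
  then have "\<exists>x\<ge>0. x \<le> b \<and> h x = 1 / r"
    using r hb b h0 by (intro IVT') auto
  then obtain x where x: "0 \<le> x" "h x = 1 / r" by blast
  have "x \<noteq> 0" using x h0 r by auto
  then have "is_eps0 r m x" using x by (simp add: is_eps0_def h_def)
  moreover have "y = x" if "is_eps0 r m y" for y
  proof (rule ccontr)
    assume "y \<noteq> x"
    then consider "x < y" | "y < x" by linarith
    then show False
      using that x power_mult_exp_strict_mono[of x y "m - 1"]
        power_mult_exp_strict_mono[of y x "m - 1"]
      by cases (auto simp: is_eps0_def h_def)
  qed
  ultimately show ?thesis by blast
qed

lemma is_eps0_eps0:
  assumes "0 < r" "2 \<le> m"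
  shows "is_eps0 r m (eps0 r m)"
  unfolding eps0_def using ex1_is_eps0[OF assms] by (rule theI')

text \<open>The contraction factor \<open>\<bar>\<lambda>\<bar> s\<^sup>m\<^sup>-\<^sup>1 e\<^sup>s\<close> increases with \<open>s\<close>, so its value at the
  starting point bounds every later step, as the moduli along the orbit do not increase.\<close>

lemma iterate_decay:
  assumes m: "1 \<le> m" and q: "cmod lam * cmod z ^ (m - 1) * exp (cmod z) \<le> q" "q \<le> 1"
  shows "cmod ((F lam m ^^ n) z) \<le> q ^ n * cmod z"
proof (induction n)
  case 0
  then show ?case by simp
next
  case (Suc n)
  define w where "w = (F lam m ^^ n) z"
  have q0: "0 \<le> q" using q(1) by (rule order_trans[rotated]) simp
  have "q ^ n * cmod z \<le> cmod z"
    using q0 q(2) by (simp add: mult_left_le_one_le power_le_one)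
  with Suc have w: "cmod w \<le> cmod z" by (simp add: w_def)
  have "cmod (F lam m w) = cmod lam * cmod w ^ (m - 1) * exp (Re w) * cmod w"
    using m by (simp add: F_def norm_mult norm_power power_eq_if[of _ m])
  also have "\<dots> \<le> cmod lam * cmod z ^ (m - 1) * exp (cmod z) * cmod w"
    using w complex_Re_le_cmod[of w]
    by (intro mult_right_mono mult_mono power_mono) auto
  also have "\<dots> \<le> q * cmod w" using q(1) by (rule mult_right_mono) simp
  also have "\<dots> \<le> q * (q ^ n * cmod z)"
    using Suc q0 by (intro mult_left_mono) (auto simp: w_def)
  finally show ?case by (simp add: w_def mult.assoc)
qed

lemma ball_eps0_subset_immediate_basin0:
  assumes m: "2 \<le> m" and lam: "lam \<noteq> 0"
  shows "ball 0 (eps0 (cmod lam) m) \<subseteq> immediate_basin0 lam m"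
proof -
  define e where "e = eps0 (cmod lam) m"
  have e: "0 < e" "e ^ (m - 1) * exp e = 1 / cmod lam"
    using is_eps0_eps0[of "cmod lam" m] m lam by (auto simp: e_def is_eps0_def)
  have "z \<in> basin0 lam m" if z: "z \<in> ball 0 e" for z
  proof -
    define q where "q = cmod lam * cmod z ^ (m - 1) * exp (cmod z)"
    have "cmod z ^ (m - 1) * exp (cmod z) < 1 / cmod lam"
      using power_mult_exp_strict_mono[of "cmod z" e "m - 1"] z e(2) by simp
    then have q1: "q < 1"
      using lam by (simp add: q_def field_simps)
    have q0: "0 \<le> q" by (simp add: q_def)
    have bd: "cmod ((F lam m ^^ n) z) \<le> q ^ n * cmod z" for n
      using m q1 by (intro iterate_decay) (auto simp: q_def)
    have "(\<lambda>n. q ^ n * cmod z) \<longlonglongrightarrow> 0"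
      using q0 q1 by (intro tendsto_mult_left_zero LIMSEQ_realpow_zero) auto
    then have "(\<lambda>n. (F lam m ^^ n) z) \<longlonglongrightarrow> 0"
      by (rule Lim_null_comparison[OF always_eventually, rotated]) (use bd in blast)
    then show ?thesis by (simp add: basin0_def)
  qed
  then have "ball 0 e \<subseteq> basin0 lam m" by blast
  then show ?thesis
    unfolding immediate_basin0_def e_def[symmetric]
    using e(1) by (intro connected_component_maximal) auto
qed

section \<open>The region on the left\<close>

lemma exp_beats_power_at_left:
  fixes r e :: real
  assumes "0 < e"
  shows "\<exists>X < -1. \<forall>x<X. r * (2 * x\<^sup>2) ^ m * exp x < e"
proof -
  have "((\<lambda>t::real. (r * 2 ^ m) * (t ^ (2 * m) / exp t)) \<longlongrightarrow> (r * 2 ^ m) * 0) at_top"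
    by (intro tendsto_intros tendsto_power_div_exp_0)
  then have "\<forall>\<^sub>F t::real in at_top. (r * 2 ^ m) * (t ^ (2 * m) / exp t) < e"
    using assms by (intro order_tendstoD(2)) auto
  then obtain T where T: "(r * 2 ^ m) * (t ^ (2 * m) / exp t) < e" if "T \<le> t" for t
    unfolding eventually_at_top_linorder by blast
  have "r * (2 * x\<^sup>2) ^ m * exp x < e" if "x < min (- T) (- 2)" for x
  proof -
    have "(- x) ^ (2 * m) = (x\<^sup>2) ^ m" by (simp add: power_mult)
    then show ?thesis
      using T[of "- x"] that by (simp add: power_mult_distrib exp_minus divide_inverse mult_ac)
  qed
  then show ?thesis by (intro exI[of _ "min (- T) (- 2)"]) auto
qed

lemma H_region_iff: "z \<in> H_region X C \<longleftrightarrow> Re z < X \<and> \<bar>Im z\<bar> < C (Re z)"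
  by (cases z) (auto simp: H_region_def)

lemma open_H_region:
  assumes "continuous_on UNIV C"
  shows "open (H_region X C)"
proof -
  have "H_region X C = {z. Re z < X} \<inter> {z. \<bar>Im z\<bar> < C (Re z)}"
    by (auto simp: H_region_iff)
  moreover have "continuous_on UNIV (\<lambda>z. C (Re z))"
    by (rule continuous_on_compose2[OF assms]) (auto intro: continuous_intros)
  ultimately show ?thesis
    by (simp add: open_Int open_Collect_less continuous_on_id continuous_intros)
qed

lemma H_region_maps_into_ball:
  assumes X: "X < -1" and small: "\<And>x. x < X \<Longrightarrow> cmod lam * (2 * x\<^sup>2) ^ m * exp x < e"
  shows "F lam m ` H_region X (\<lambda>x. x\<^sup>2) \<subseteq> ball 0 e"
proof (clarsimp simp: H_region_iff)
  fix z assume z: "Re z < X" "\<bar>Im z\<bar> < (Re z)\<^sup>2"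
  have "\<bar>Re z\<bar> * 1 \<le> \<bar>Re z\<bar> * \<bar>Re z\<bar>"
    using z X by (intro mult_left_mono) auto
  then have "\<bar>Re z\<bar> \<le> (Re z)\<^sup>2" by (simp add: power2_eq_square)
  then have "cmod z \<le> 2 * (Re z)\<^sup>2"
    using cmod_le[of z] z by linarith
  then have "cmod z ^ m \<le> (2 * (Re z)\<^sup>2) ^ m" by (rule power_mono) simp
  then have "cmod (F lam m z) \<le> cmod lam * (2 * (Re z)\<^sup>2) ^ m * exp (Re z)"
    unfolding F_def norm_mult norm_power norm_exp_eq_Re
    by (intro mult_right_mono mult_left_mono) auto
  with small[OF z(1)] show "cmod (F lam m z) < e" by linarith
qed

section \<open>The strips\<close>

definition half_strip :: "real \<Rightarrow> real \<Rightarrow> real \<Rightarrow> complex set" where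
  "half_strip c a b = {z. a < Re z \<and> \<bar>Im z - c\<bar> < b}"

lemma open_half_strip: "open (half_strip c a b)"
  unfolding half_strip_def
  by (intro open_Collect_conj open_Collect_less continuous_intros)

lemma convex_half_strip: "convex (half_strip c a b)"
proof -
  have "half_strip c a b = {z. a < Re z} \<inter> {z. c - b < Im z} \<inter> {z. Im z < c + b}"
    by (auto simp: half_strip_def)
  then show ?thesis
    by (simp add: convex_Int convex_halfspace_Re_gt convex_halfspace_Im_gt convex_halfspace_Im_lt)
qed

lemma half_strips_meet:
  assumes "0 < b" "0 < b'"
  shows "half_strip c a b \<inter> half_strip c a' b' \<noteq> {}"
proof -
  have "Complex (max a a' + 1) c \<in> half_strip c a b \<inter> half_strip c a' b'"
    using assms by (auto simp: half_strip_def)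
  then show ?thesis by blast
qed

text \<open>Since \<open>z\<^sup>m = x\<^sup>m (1 + iy/x)\<^sup>m\<close>, this is the uniform form of \<open>z\<^sup>m \<sim> x\<^sup>m\<close> for bounded
  imaginary part.\<close>

lemma power_one_plus_imag_quotient:
  assumes e: "0 < e"
  shows "\<exists>a>0. \<forall>x y. a < x \<and> \<bar>y\<bar> \<le> B \<longrightarrow> cmod ((1 + \<i> * of_real (y / x)) ^ m - 1) < e"
proof -
  have "isCont (\<lambda>u::complex. (1 + u) ^ m) 0" by (intro continuous_intros)
  then obtain d where d: "0 < d" "\<And>u::complex. cmod u < d \<Longrightarrow> cmod ((1 + u) ^ m - 1) < e"
    using e unfolding continuous_at_eps_delta by (auto simp: dist_norm)
  define a where "a = max 1 (\<bar>B\<bar> / d)"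
  have "cmod ((1 + \<i> * of_real (y / x)) ^ m - 1) < e" if "a < x" "\<bar>y\<bar> \<le> B" for x y
  proof (rule d(2))
    have x: "0 < x" "\<bar>B\<bar> / d < x" using that by (auto simp: a_def)
    then have "\<bar>y\<bar> < d * x"
      using that(2) d(1) by (simp add: field_simps)
    then show "cmod (\<i> * of_real (y / x)) < d"
      using x by (simp add: norm_mult norm_divide field_simps)
  qed
  moreover have "0 < a" by (simp add: a_def)
  ultimately show ?thesis by blast
qed

text \<open>With \<open>R = \<bar>\<lambda>\<bar> x\<^sup>m e\<^sup>x\<close> one has \<open>F z = -R w\<close>, where \<open>w = e\<^sup>i\<^sup>(\<^sup>y\<^sup>-\<^sup>c\<^sup>) (1 + iy/x)\<^sup>m\<close> is
  close to a point of the unit circle with real part at least \<open>cos b > 0\<close>.  So the real part of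
  \<open>F z\<close> is at most \<open>-R cos b / 2\<close> while the imaginary part is at most \<open>2R\<close>, and
  for large \<open>R\<close> the parabolic boundary of the region is cleared.\<close>

lemma half_strip_maps_into_H:
  assumes lam: "lam \<noteq> 0" and c: "lam * cis c = - of_real (cmod lam)"
    and b: "0 < b" "b < pi / 2"
  shows "\<exists>a. F lam m ` half_strip c a b \<subseteq> H_region X (\<lambda>x. x\<^sup>2)"
proof -
  define h where "h = cos b / 2"
  have h: "0 < h" "h < 1"
    using cos_gt_zero[OF b] cos_le_one[of b] unfolding h_def by linarith+
  \<comment> \<open>Beyond \<open>M\<close>, the quantity \<open>R\<close> below satisfies both \<open>h R > \<bar>X\<bar>\<close> and \<open>(h R)\<^sup>2 > 2 R\<close>,
    which are the two conditions for membership in the region.\<close>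
  define M where "M = max 1 (max (\<bar>X\<bar> / h) (2 / h\<^sup>2)) + 1"
  obtain a1 where a1: "0 < a1"
      "\<And>x y. a1 < x \<Longrightarrow> \<bar>y\<bar> \<le> \<bar>c\<bar> + b \<Longrightarrow> cmod ((1 + \<i> * of_real (y / x)) ^ m - 1) < h"
    using power_one_plus_imag_quotient[OF h(1)] by blast
  define a where "a = max a1 (max 1 (M / cmod lam))"
  have "F lam m z \<in> H_region X (\<lambda>x. x\<^sup>2)" if z: "z \<in> half_strip c a b" for z
  proof -
    define x y where "x = Re z" and "y = Im z"
    have x: "a1 < x" "1 < x" "M / cmod lam < x" and y: "\<bar>y - c\<bar> < b"
      using z by (auto simp: half_strip_def a_def x_def y_def)
    \<comment> \<open>\<open>R\<close> would be \<open>\<bar>F z\<bar>\<close> if \<open>z\<close> were replaced by \<open>x\<close>.\<close>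
    define R where "R = cmod lam * x ^ m * exp x"
    define p where "p = (1 + \<i> * of_real (y / x)) ^ m"
    define w where "w = cis (y - c) * p"
    have p: "cmod (p - 1) < h" unfolding p_def using x y by (intro a1) auto
    have "z = of_real x * (1 + \<i> * of_real (y / x))"
      using x by (auto simp: complex_eq_iff x_def y_def)
    then have zm: "z ^ m = of_real (x ^ m) * p"
      by (simp add: p_def power_mult_distrib)
    have ez: "exp z = of_real (exp x) * (cis c * cis (y - c))"
      by (simp add: exp_eq_polar cis_mult x_def y_def)
    have "F lam m z = (lam * cis c) * of_real (x ^ m) * of_real (exp x) * w"
      unfolding F_def zm ez w_def by (simp add: algebra_simps)
    then have Fz: "F lam m z = - of_real R * w"
      by (simp add: c R_def)
    have "cmod (w - cis (y - c)) = cmod (cis (y - c) * (p - 1))"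
      by (simp add: w_def algebra_simps)
    then have wc: "cmod (w - cis (y - c)) < h"
      using p by (simp add: norm_mult)
    have "cos b \<le> cos \<bar>y - c\<bar>"
      using y b by (intro cos_monotone_0_pi_le) auto
    then have "2 * h \<le> cos (y - c)" by (simp add: h_def)
    moreover have "\<bar>Re w - cos (y - c)\<bar> < h"
      using wc abs_Re_le_cmod[of "w - cis (y - c)"] by simp
    ultimately have Rew: "h < Re w" by linarith
    have "\<bar>Im w - sin (y - c)\<bar> < h"
      using wc abs_Im_le_cmod[of "w - cis (y - c)"] by simp
    then have Imw: "\<bar>Im w\<bar> < 2"
      using h abs_sin_le_one[of "y - c"] by linarith
    have "M < cmod lam * x" using x(3) lam by (simp add: field_simps)
    also have "\<dots> \<le> cmod lam * (x ^ m * exp x)"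
    proof (rule mult_left_mono)
      have "x \<le> 1 * exp x" using exp_ge_add_one_self[of x] by linarith
      also have "\<dots> \<le> x ^ m * exp x"
        using x(2) by (intro mult_right_mono one_le_power) auto
      finally show "x \<le> x ^ m * exp x" .
    qed simp
    also have "\<dots> = R" by (simp add: R_def mult.assoc)
    finally have "M < R" .
    then have R: "1 < R" "\<bar>X\<bar> / h < R" "2 / h\<^sup>2 < R"
      by (auto simp: M_def)
    have hR: "h * R < Re w * R" using Rew R by simp
    have "\<bar>X\<bar> < h * R" using R(2) h by (simp add: field_simps)
    with hR have "\<bar>X\<bar> < Re w * R" by linarith
    then have "Re (F lam m z) < X" unfolding Fz by (simp add: mult.commute)
    moreover have "\<bar>Im (F lam m z)\<bar> < (Re (F lam m z))\<^sup>2"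
    proof -
      have "\<bar>Im (F lam m z)\<bar> = R * \<bar>Im w\<bar>" using R unfolding Fz by (simp add: abs_mult)
      also have "\<dots> < R * 2" using Imw R by simp
      also have "\<dots> < R * (R * h\<^sup>2)"
        using R h by (intro mult_strict_left_mono) (auto simp: field_simps)
      also have "\<dots> = (h * R)\<^sup>2" by (simp add: power2_eq_square)
      also have "\<dots> < (Re w * R)\<^sup>2"
        using hR h R by (intro power_strict_mono) auto
      finally show ?thesis unfolding Fz by (simp add: mult.commute)
    qed
    ultimately show ?thesis by (simp add: H_region_iff)
  qed
  then show ?thesis by (intro exI[of _ a]) blast
qed

text \<open>Taking every half-strip that is mapped into \<open>H\<close> makes the
  inclusion and openness automatic and avoids choosing a boundary curve.\<close>

definition preimage_strip :: "complex \<Rightarrow> nat \<Rightarrow> complex set \<Rightarrow> real \<Rightarrow> complex set" where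
  "preimage_strip lam m H c =
     \<Union>{half_strip c a b | a b. 0 < b \<and> b < pi / 2 \<and> F lam m ` half_strip c a b \<subseteq> H}"

lemma preimage_strip_maps_into: "F lam m ` preimage_strip lam m H c \<subseteq> H"
  unfolding preimage_strip_def by blast

lemma preimage_strip_band: "z \<in> preimage_strip lam m H c \<Longrightarrow> \<bar>Im z - c\<bar> < pi / 2"
  unfolding preimage_strip_def half_strip_def by auto

lemma horizontal_strip_preimage_strip:
  assumes ex: "\<And>b. 0 < b \<Longrightarrow> b < pi / 2 \<Longrightarrow> \<exists>a. F lam m ` half_strip c a b \<subseteq> H"
  shows "horizontal_strip pi (preimage_strip lam m H c)"
proof -
  define S where "S = preimage_strip lam m H c"
  have "open S"
    unfolding S_def preimage_strip_def by (auto intro!: open_Union open_half_strip)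
  moreover have "connected S"
    unfolding connected_iff_connected_component
  proof (intro ballI)
    fix u v assume "u \<in> S" "v \<in> S"
    then obtain a b a' b' where
      u: "u \<in> half_strip c a b" "0 < b" "half_strip c a b \<subseteq> S" and
      v: "v \<in> half_strip c a' b'" "0 < b'" "half_strip c a' b' \<subseteq> S"
      unfolding S_def preimage_strip_def by blast
    have "connected (half_strip c a b \<union> half_strip c a' b')"
      using half_strips_meet[OF u(2) v(2)]
      by (intro connected_Un convex_connected convex_half_strip) auto
    then show "connected_component S u v"
      unfolding connected_component_def using u v by blast
  qed
  moreover have "\<exists>xs. \<forall>x\<ge>xs. Complex x y \<in> S" if y: "\<bar>y - c\<bar> < pi / 2" for y
  proof -
    obtain b where b: "\<bar>y - c\<bar> < b" "b < pi / 2" using dense[OF y] by blast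
    then have b0: "0 < b" by linarith
    obtain a where a: "F lam m ` half_strip c a b \<subseteq> H" using ex[OF b0 b(2)] by blast
    have "Complex x y \<in> S" if "a + 1 \<le> x" for x
    proof -
      have "Complex x y \<in> half_strip c a b" using that b by (simp add: half_strip_def)
      then show ?thesis unfolding S_def preimage_strip_def using a b b0 by blast
    qed
    then show ?thesis by blast
  qed
  moreover have "\<exists>xs. \<forall>x\<ge>xs. Complex x y \<notin> S" if "\<bar>y - c\<bar> > pi / 2" for y
    using that preimage_strip_band[of "Complex _ y" lam m H c] by (fastforce simp: S_def)
  ultimately show ?thesis
    unfolding horizontal_strip_def S_def[symmetric] using pi_gt_zero by blast
qed

lemma infinitely_many_preimage_strips:
  assumes lam: "lam \<noteq> 0"
  shows "\<exists>\<S> :: complex set set. infinite \<S> \<and> pairwise disjnt \<S> \<and>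
    (\<forall>S\<in>\<S>. horizontal_strip pi S \<and> F lam m ` S \<subseteq> H_region X (\<lambda>x. x\<^sup>2))"
proof -
  define H where "H = H_region X (\<lambda>x. x\<^sup>2)"
  \<comment> \<open>The heights at which \<open>\<lambda> e\<^sup>i\<^sup>c\<close> is negative; their spacing \<open>2\<pi>\<close> exceeds the width \<open>\<pi>\<close> of
    a strip, whence disjointness.\<close>
  define c where "c k = pi - Arg lam + 2 * pi * real k" for k :: nat
  define S where "S k = preimage_strip lam m H (c k)" for k
  have c: "lam * cis (c k) = - of_real (cmod lam)" for k
  proof -
    have "cis (2 * pi * real k) = 1" by (rule cis_multiple_2pi) auto
    moreover have "cis (Arg lam) * cis (pi - Arg lam) = -1" by (simp add: cis_mult)
    moreover have "lam = of_real (cmod lam) * cis (Arg lam)"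
      using rcis_cmod_Arg[of lam] by (simp add: rcis_def)
    ultimately have "lam * (cis (pi - Arg lam) * cis (2 * pi * real k)) = - of_real (cmod lam)"
      by (metis mult.assoc mult.right_neutral mult_minus1_right)
    then show ?thesis by (simp only: c_def cis_mult)
  qed
  have strip: "horizontal_strip pi (S k)" for k
    unfolding S_def H_def
    by (intro horizontal_strip_preimage_strip half_strip_maps_into_H lam c)
  have disj: "disjnt (S j) (S k)" if "j < k" for j k
  proof (rule ccontr)
    assume "\<not> disjnt (S j) (S k)"
    then obtain z where "z \<in> S j" "z \<in> S k" by (auto simp: disjnt_def)
    then have "\<bar>Im z - c j\<bar> < pi / 2" "\<bar>Im z - c k\<bar> < pi / 2"
      unfolding S_def by (auto dest: preimage_strip_band)
    then have "c k - c j < pi" by linarith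
    moreover have "pi * 1 \<le> pi * (2 * (real k - real j))"
      using that by (intro mult_left_mono) auto
    ultimately show False by (simp add: c_def algebra_simps)
  qed
  have disj': "disjnt (S j) (S k)" if "j \<noteq> k" for j k
    using disj[of j k] disj[of k j] that by (metis disjnt_sym linorder_neqE_nat)
  have ne: "S k \<noteq> {}" for k
  proof -
    obtain c' where "\<And>y. \<bar>y - c'\<bar> < pi / 2 \<Longrightarrow> \<exists>xs. \<forall>x\<ge>xs. Complex x y \<in> S k"
      using strip[of k] unfolding horizontal_strip_def by blast
    from this[of c'] show ?thesis by auto
  qed
  have "inj S"
  proof (rule injI, rule ccontr)
    fix j k assume "S j = S k" "j \<noteq> k"
    then show False using disj'[of j k] ne[of k] by (simp add: disjnt_def)
  qed
  then have "infinite (range S)" by (rule range_inj_infinite)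
  moreover have "pairwise disjnt (range S)"
    by (auto simp: pairwise_def intro: disj')
  moreover have "F lam m ` S k \<subseteq> H" for k
    unfolding S_def by (rule preimage_strip_maps_into)
  ultimately show ?thesis
    using strip unfolding H_def by (intro exI[of _ "range S"]) simp
qed

section \<open>A region depending only on the modulus and the degree\<close>

theorem theoremA:
  shows "(\<forall>(m::nat) (lam::complex). 2 \<le> m \<and> lam \<noteq> 0 \<longrightarrow>
            (\<exists>!x. is_eps0 (cmod lam) m x) \<and>
            ball 0 (eps0 (cmod lam) m) \<subseteq> immediate_basin0 lam m) \<and>
         (\<exists>(x0 :: real \<Rightarrow> nat \<Rightarrow> real) (C :: real \<Rightarrow> nat \<Rightarrow> real \<Rightarrow> real).
            \<forall>(m::nat) (lam::complex). 2 \<le> m \<and> lam \<noteq> 0 \<longrightarrow>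
              (let X = x0 (cmod lam) m; c = C (cmod lam) m; H = H_region X c in
                 X < 0 \<and> (\<forall>x\<in>{..<X}. 0 \<le> c x) \<and>
                 open H \<and> F lam m ` H \<subseteq> ball 0 (eps0 (cmod lam) m) \<and>
                 (\<exists>\<S> :: complex set set.
                    infinite \<S> \<and> pairwise disjnt \<S> \<and>
                    (\<forall>S\<in>\<S>. horizontal_strip pi S \<and> F lam m ` S \<subseteq> H))))"
    (is "?disk \<and> ?strips")
proof
  show ?disk
    using ex1_is_eps0 ball_eps0_subset_immediate_basin0 by auto
  \<comment> \<open>The smallness condition involves \<open>\<lambda>\<close> only through its modulus, so one choice of the
    edge \<open>x\<^sub>0\<close> serves all parameters of equal modulus.\<close>
  define good where "good r m X \<longleftrightarrow>
      X < -1 \<and> (\<forall>x<X. r * (2 * x\<^sup>2) ^ m * exp x < eps0 r m)" for r m and X :: real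
  define x0 where "x0 r m = (SOME X. good r m X)" for r m
  have x0: "good r m (x0 r m)" if "0 < r" "2 \<le> m" for r m
  proof -
    have "0 < eps0 r m" using is_eps0_eps0[OF that] by (simp add: is_eps0_def)
    then have "\<exists>X. good r m X" unfolding good_def by (rule exp_beats_power_at_left)
    then show ?thesis unfolding x0_def by (rule someI_ex)
  qed
  show ?strips
  proof (intro exI[of _ x0] exI[of _ "\<lambda>r m x. x\<^sup>2"] allI impI, unfold Let_def, elim conjE,
      intro conjI)
    fix m :: nat and lam :: complex assume m: "2 \<le> m" and lam: "lam \<noteq> 0"
    let ?X = "x0 (cmod lam) m"
    have X: "?X < -1" "\<And>x. x < ?X \<Longrightarrow> cmod lam * (2 * x\<^sup>2) ^ m * exp x < eps0 (cmod lam) m"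
      using x0[of "cmod lam" m] m lam by (auto simp: good_def)
    show "?X < 0" using X(1) by simp
    show "\<forall>x\<in>{..<?X}. 0 \<le> x\<^sup>2" by simp
    show "open (H_region ?X (\<lambda>x. x\<^sup>2))"
      by (intro open_H_region continuous_intros)
    show "F lam m ` H_region ?X (\<lambda>x. x\<^sup>2) \<subseteq> ball 0 (eps0 (cmod lam) m)"
      using X by (rule H_region_maps_into_ball)
    show "\<exists>\<S> :: complex set set. infinite \<S> \<and> pairwise disjnt \<S> \<and>
        (\<forall>S\<in>\<S>. horizontal_strip pi S \<and> F lam m ` S \<subseteq> H_region ?X (\<lambda>x. x\<^sup>2))"
      by (rule infinitely_many_preimage_strips[OF lam])
  qed
qed

end
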